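(* Let $X$ and $Y$ be compact spaces, let $A$ be a uniform algebra on $X$ and let $B$ be a uniform algebra on $Y$. Suppose that $B$ is a generalised Cole extension of $A$ with associated maps $\Pi:Y\to X$ and $T:C(Y)\to C(X)$, and suppose further that $\|\mathrm{id}_{C(Y)}-\Pi^*\circ T\|=1$. Then there exists a finite group $G$ such that this generalised Cole extension $B$ of $A$ is implemented by $G$. Moreover, if there exists $h_0\in B$ with $T(h_0)=0$ such that $B$ is the uniform algebra generated by $\Pi^*(A)$ and $h_0$, then there exist $h\in A$ and a homeomorphism $\psi:Y\to X^q$, where $q(t)=t^2-h$, such that $\Pi_q\circ\psi=\Pi$, $\psi^*(A^q)=B$, and $\psi^*(p_q)=h_0$.
   Context: A compact space is a non-empty compact Hausdorff space. $C(X)$ is the algebra of continuous complex-valued functions on $X$ with the uniform norm. A uniform algebra on $X$ is a closed subalgebra of $C(X)$ that contains the constants and separates the points of $X$; the uniform algebra generated by a set of functions is the uniform closure of the unital algebra they generate. For a continuous map $\Pi:Y\to X$, $\Pi^*(f)=f\circ\Pi$. $B$ is a generalised Cole extension of $A$ if there exist a continuous surjection $\Pi:Y\to X$ and a unital linear map $T:C(Y)\to C(X)$ with $\|T\|=1$ such that $T\circ\Pi^*=\mathrm{id}_{C(X)}$ and $T(B)=A$; $\Pi$ and $T$ are then called the associated maps. Let $G$ be a compact (Hausdorff) group with normalised Haar measure $\mu$ (a finite group is given the discrete topology). $G$ acts continuously on $Y$ if the action $G\times Y\to Y$ is jointly continuous. The generalised Cole extension $B$ of $A$ with associated maps $\Pi,T$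 is implemented by $G$ if $G$ acts continuously on $Y$, $G\cdot y=\Pi^{-1}(\{\Pi(y)\})$ for all $y\in Y$, and for each $f\in B$ we have $T(f)(\Pi(y))=\int_G f(s\cdot y)\,d\mu(s)$ for all $y\in Y$. For $h\in A$ and $q(t)=t^2-h$, put $X^q=\{(x,z)\in X\times\mathbb{C}: z^2-h(x)=0\}$, a compact space; let $\Pi_q:X^q\to X$ and $p_q:X^q\to\mathbb{C}$ be the restrictions of the coordinate projections, and let $A^q$ be the uniform closure in $C(X^q)$ of the algebra generated by $p_q$ and the functions $\Pi_q^*(f)$ $(f\in A)$. *)

theory Defs
  imports "HOL-Analysis.Analysis" "HOL-Algebra.Group_Action"
begin

section \<open>The algebra of continuous functions on a compact space\<close>

text \<open>
  Elements of \<open>C(X)\<close> are represented by functions that are extensional on \<open>topspace X\<close>, so that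
  HOL equality coincides with equality of functions on the space. The topology of uniform
  convergence is the one of the library metric space \<open>cfunspace X euclidean_metric\<close>; for compact
  \<open>X\<close> its carrier is \<open>C_set X\<close> (lemma \<open>mspace_cfunspace_eq_C_set\<close>).
\<close>

definition C_set :: "'a topology \<Rightarrow> ('a \<Rightarrow> complex) set" where
  "C_set X = {f. continuous_map X euclidean f \<and> f \<in> extensional (topspace X)}"

lemma mspace_cfunspace_eq_C_set:
  assumes "compact_space X"
  shows "mspace (cfunspace X (euclidean_metric :: complex metric)) = C_set X"
proof -
  have "Met_TC.mbounded (f ` topspace X)" if "continuous_map X euclidean f" for f :: "'a \<Rightarrow> complex"
    using image_compactin[OF _ that] assms
    by (metis Met_TC.compactin_imp_mbounded compact_space_def mtopology_is_euclidean)
  then show ?thesis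
    by (auto simp: C_set_def)
qed

abbreviation uniform_closure_of :: "'a topology \<Rightarrow> ('a \<Rightarrow> complex) set \<Rightarrow> ('a \<Rightarrow> complex) set" where
  "uniform_closure_of X S \<equiv> mtopology_of (cfunspace X euclidean_metric) closure_of S"

definition sup_norm :: "'a topology \<Rightarrow> ('a \<Rightarrow> complex) \<Rightarrow> real" where
  "sup_norm X f = (SUP x\<in>topspace X. cmod (f x))"

text \<open>The norm takes values in the extended reals, so that unbounded operators have norm \<open>\<infinity>\<close>.\<close>

definition op_norm ::
    "'a topology \<Rightarrow> 'b topology \<Rightarrow> (('a \<Rightarrow> complex) \<Rightarrow> ('b \<Rightarrow> complex)) \<Rightarrow> ereal" where
  "op_norm X Y S = (SUP f\<in>{f \<in> C_set X. sup_norm X f \<le> 1}. ereal (sup_norm Y (S f)))"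

definition unital_subalgebra :: "'a topology \<Rightarrow> ('a \<Rightarrow> complex) set \<Rightarrow> bool" where
  "unital_subalgebra X A \<longleftrightarrow>
     A \<subseteq> C_set X \<and>
     (\<forall>c. (\<lambda>x\<in>topspace X. c) \<in> A) \<and>
     (\<forall>f\<in>A. \<forall>g\<in>A. (\<lambda>x\<in>topspace X. f x + g x) \<in> A) \<and>
     (\<forall>f\<in>A. \<forall>g\<in>A. (\<lambda>x\<in>topspace X. f x * g x) \<in> A) \<and>
     (\<forall>c. \<forall>f\<in>A. (\<lambda>x\<in>topspace X. c * f x) \<in> A)"

definition uniform_algebra :: "'a topology \<Rightarrow> ('a \<Rightarrow> complex) set \<Rightarrow> bool" where
  "uniform_algebra X A \<longleftrightarrow>
     unital_subalgebra X A \<and>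
     closedin (mtopology_of (cfunspace X euclidean_metric)) A \<and>
     (\<forall>x\<in>topspace X. \<forall>y\<in>topspace X. x \<noteq> y \<longrightarrow> (\<exists>f\<in>A. f x \<noteq> f y))"

definition generated_uniform_algebra ::
    "'a topology \<Rightarrow> ('a \<Rightarrow> complex) set \<Rightarrow> ('a \<Rightarrow> complex) set" where
  "generated_uniform_algebra X S = uniform_closure_of X (unital_subalgebra X hull S)"

definition pullback ::
    "'b topology \<Rightarrow> ('b \<Rightarrow> 'a) \<Rightarrow> ('a \<Rightarrow> complex) \<Rightarrow> ('b \<Rightarrow> complex)" where
  "pullback Y proj f = (\<lambda>y\<in>topspace Y. f (proj y))"

section \<open>Generalised Cole extensions\<close>

definition complex_linear_on_C ::
    "'a topology \<Rightarrow> 'b topology \<Rightarrow> (('a \<Rightarrow> complex) \<Rightarrow> ('b \<Rightarrow> complex)) \<Rightarrow> bool" where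
  "complex_linear_on_C X Y S \<longleftrightarrow>
     S \<in> C_set X \<rightarrow> C_set Y \<and>
     (\<forall>f\<in>C_set X. \<forall>g\<in>C_set X.
        S (\<lambda>x\<in>topspace X. f x + g x) = (\<lambda>y\<in>topspace Y. S f y + S g y)) \<and>
     (\<forall>c. \<forall>f\<in>C_set X. S (\<lambda>x\<in>topspace X. c * f x) = (\<lambda>y\<in>topspace Y. c * S f y))"

definition generalised_Cole_extension ::
    "'x topology \<Rightarrow> ('x \<Rightarrow> complex) set \<Rightarrow> 'y topology \<Rightarrow> ('y \<Rightarrow> complex) set \<Rightarrow>
     ('y \<Rightarrow> 'x) \<Rightarrow> (('y \<Rightarrow> complex) \<Rightarrow> ('x \<Rightarrow> complex)) \<Rightarrow> bool" where
  "generalised_Cole_extension X A Y B proj T \<longleftrightarrow>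
     continuous_map Y X proj \<and> proj ` topspace Y = topspace X \<and>
     complex_linear_on_C Y X T \<and>
     T (\<lambda>y\<in>topspace Y. 1) = (\<lambda>x\<in>topspace X. 1) \<and>
     op_norm Y X T = 1 \<and>
     (\<forall>f\<in>C_set X. T (pullback Y proj f) = f) \<and>
     T ` B = A"

section \<open>Compact groups and implementation\<close>

definition compact_group :: "'g monoid \<Rightarrow> 'g topology \<Rightarrow> bool" where
  "compact_group G \<tau> \<longleftrightarrow>
     group G \<and> topspace \<tau> = carrier G \<and> compact_space \<tau> \<and> Hausdorff_space \<tau> \<and>
     continuous_map (prod_topology \<tau> \<tau>) \<tau> (\<lambda>(s, t). s \<otimes>\<^bsub>G\<^esub> t) \<and>
     continuous_map \<tau> \<tau> (\<lambda>s. inv\<^bsub>G\<^esub> s)"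

text \<open>The left-invariant regular Borel probability measure.\<close>

definition normalised_Haar_measure :: "'g monoid \<Rightarrow> 'g topology \<Rightarrow> 'g measure \<Rightarrow> bool" where
  "normalised_Haar_measure G \<tau> \<mu> \<longleftrightarrow>
     space \<mu> = carrier G \<and>
     sets \<mu> = sigma_sets (carrier G) {U. openin \<tau> U} \<and>
     emeasure \<mu> (carrier G) = 1 \<and>
     (\<forall>s\<in>carrier G. \<forall>E\<in>sets \<mu>. emeasure \<mu> (s <#\<^bsub>G\<^esub> E) = emeasure \<mu> E) \<and>
     (\<forall>E\<in>sets \<mu>. emeasure \<mu> E = (INF U\<in>{U. openin \<tau> U \<and> E \<subseteq> U}. emeasure \<mu> U)) \<and>
     (\<forall>U. openin \<tau> U \<longrightarrow>
        emeasure \<mu> U = (SUP K\<in>{K. compactin \<tau> K \<and> K \<subseteq> U}. emeasure \<mu> K))"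

definition continuous_action ::
    "'g monoid \<Rightarrow> 'g topology \<Rightarrow> 'y topology \<Rightarrow> ('g \<Rightarrow> 'y \<Rightarrow> 'y) \<Rightarrow> bool" where
  "continuous_action G \<tau> Y \<phi> \<longleftrightarrow>
     group_action G (topspace Y) \<phi> \<and>
     continuous_map (prod_topology \<tau> Y) Y (\<lambda>(s, y). \<phi> s y)"

text \<open>
  The generalised Cole extension \<open>B\<close> with associated maps \<open>proj\<close>, \<open>T\<close> is implemented by the compact
  group \<open>G\<close> with topology \<open>\<tau>\<close>. Since the normalised Haar measure exists and is unique, binding it
  existentially is the same as referring to it by name.
\<close>

definition implemented_by ::
    "'x topology \<Rightarrow> 'y topology \<Rightarrow> ('y \<Rightarrow> complex) set \<Rightarrow>
     ('y \<Rightarrow> 'x) \<Rightarrow> (('y \<Rightarrow> complex) \<Rightarrow> ('x \<Rightarrow> complex)) \<Rightarrow> 'g monoid \<Rightarrow> 'g topology \<Rightarrow> bool" where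
  "implemented_by X Y B proj T G \<tau> \<longleftrightarrow>
     compact_group G \<tau> \<and>
     (\<exists>\<phi> \<mu>. continuous_action G \<tau> Y \<phi> \<and> normalised_Haar_measure G \<tau> \<mu> \<and>
        (\<forall>y\<in>topspace Y. orbit G \<phi> y = {y' \<in> topspace Y. proj y' = proj y}) \<and>
        (\<forall>f\<in>B. \<forall>y\<in>topspace Y.
           integrable \<mu> (\<lambda>s. f (\<phi> s y)) \<and> T f (proj y) = (LINT s|\<mu>. f (\<phi> s y))))"

section \<open>Adjoining a square root\<close>

text \<open>The constructions \<open>X\<^sup>q\<close>, \<open>\<Pi>\<^sub>q\<close>, \<open>p\<^sub>q\<close>, \<open>A\<^sup>q\<close> for \<open>q(t) = t\<^sup>2 - h\<close>.\<close>

definition sqrt_space :: "'x topology \<Rightarrow> ('x \<Rightarrow> complex) \<Rightarrow> ('x \<times> complex) topology" where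
  "sqrt_space X h =
     subtopology (prod_topology X euclidean) {(x, z). x \<in> topspace X \<and> z\<^sup>2 - h x = 0}"

definition sqrt_proj :: "'x topology \<Rightarrow> ('x \<Rightarrow> complex) \<Rightarrow> 'x \<times> complex \<Rightarrow> 'x" where
  "sqrt_proj X h = restrict fst (topspace (sqrt_space X h))"

definition sqrt_fun :: "'x topology \<Rightarrow> ('x \<Rightarrow> complex) \<Rightarrow> 'x \<times> complex \<Rightarrow> complex" where
  "sqrt_fun X h = restrict snd (topspace (sqrt_space X h))"

definition sqrt_algebra ::
    "'x topology \<Rightarrow> ('x \<Rightarrow> complex) set \<Rightarrow> ('x \<Rightarrow> complex) \<Rightarrow> ('x \<times> complex \<Rightarrow> complex) set" where
  "sqrt_algebra X A h =
     generated_uniform_algebra (sqrt_space X h)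
       (insert (sqrt_fun X h) (pullback (sqrt_space X h) (sqrt_proj X h) ` A))"

end

theory Submission
  imports Defs
begin

text \<open>
  Fix \<open>x\<close> in \<open>X\<close>. The functional \<open>f \<mapsto> T f x\<close> has norm \<open>1\<close> and value \<open>1\<close> at the constant \<open>1\<close>, so it is
  integration against a probability measure, and \<open>T \<circ> \<Pi>\<^sup>* = id\<close> concentrates this measure on the fibre
  over \<open>x\<close>. For a point \<open>y\<close> of the fibre carrying mass \<open>m\<close>, the functional \<open>f \<mapsto> f y - T f x\<close> has norm
  \<open>2 (1 - m)\<close>. The hypothesis on \<open>id - \<Pi>\<^sup>* \<circ> T\<close> therefore says that every point of every fibre has mass
  at least \<open>1/2\<close>. So a fibre has at most two points, and in either case
  \<open>T f (\<Pi> y) = (f y + f (\<sigma> y)) / 2\<close>, where \<open>\<sigma>\<close> exchanges the points of each fibre.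
  The argument below tests these facts directly on Urysohn functions instead of representing
  the functional by a measure: \<open>supported_on_fibre\<close> is the concentration, \<open>half_mass\<close> the lower bound on
  the masses, \<open>fibre_average\<close> the resulting formula.

  The formula expresses \<open>f \<circ> \<sigma>\<close> through continuous functions, so \<open>\<sigma>\<close> is a continuous involution
  (\<open>fibre_involution\<close>), and the group of order two acting through it implements the extension.

  If \<open>T h0 = 0\<close>, then \<open>h0 \<circ> \<sigma> = - h0\<close>. Hence \<open>h0\<^sup>2\<close> is constant on fibres and equals \<open>h \<circ> \<Pi>\<close> for
  \<open>h = T (h0\<^sup>2)\<close> in \<open>A\<close>. The map \<open>\<psi> = (\<Pi>, h0)\<close> is onto \<open>X\<^sup>q\<close> because \<open>h0\<close> takes both square roots on
  each fibre. It is injective because \<open>\<Pi>\<^sup>*(A)\<close> and \<open>h0\<close> generate \<open>B\<close>, which separates the points of \<open>Y\<close>.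
  So it is a homeomorphism, and it carries the generators of \<open>A\<^sup>q\<close> to those of \<open>B\<close>.
\<close>

section \<open>Continuous complex-valued maps\<close>

lemma continuous_map_mult_complex:
  fixes f g :: "'a \<Rightarrow> complex"
  assumes "continuous_map X euclidean f" "continuous_map X euclidean g"
  shows "continuous_map X euclidean (\<lambda>x. f x * g x)"
  using assms by (simp add: continuous_map_atin tendsto_mult)

lemma continuous_map_complex_of_real:
  assumes "continuous_map X euclideanreal g"
  shows "continuous_map X euclidean (\<lambda>x. complex_of_real (g x))"
  using assms by (simp add: continuous_map_atin tendsto_of_real)

lemmas continuous_map_complex_intros = continuous_map_add continuous_map_diff continuous_map_minus continuous_map_mult_complex
  continuous_map_complex_of_real continuous_map_const[THEN iffD2]

lemma continuous_map_compact_bounded: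
  fixes f :: "'a \<Rightarrow> complex"
  assumes "compact_space X" "continuous_map X euclidean f"
  obtains C where "C > 0" "\<And>x. x \<in> topspace X \<Longrightarrow> cmod (f x) \<le> C"
proof -
  have "compact (f ` topspace X)"
    using image_compactin[OF _ assms(2)] assms(1) by (simp add: compact_space_def)
  then have "bounded (f ` topspace X)"
    by (rule compact_imp_bounded)
  then show ?thesis
    using that unfolding bounded_pos by auto
qed

section \<open>The averaging functional of a single fibre\<close>

text \<open>
  The functional \<open>\<Lambda> f = T f x\<close> for a fixed \<open>x\<close>, written for all continuous functions rather than
  for their extensional representatives. The assumption \<open>defect\<close> is where
  \<open>\<parallel>id - \<Pi>\<^sup>* \<circ> T\<parallel> \<le> 1\<close> enters: evaluation at a point over \<open>x\<close> differs from \<open>\<Lambda>\<close> by at most \<open>1\<close> in norm.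
\<close>

locale fibre_functional =
  fixes X :: "'x topology" and Y :: "'y topology" and proj :: "'y \<Rightarrow> 'x"
    and x :: 'x and \<Lambda> :: "('y \<Rightarrow> complex) \<Rightarrow> complex"
  assumes X: "compact_space X" "Hausdorff_space X" and Y: "compact_space Y" "Hausdorff_space Y"
    and proj: "continuous_map Y X proj" and x: "x \<in> topspace X"
    and add: "\<And>f g. \<lbrakk>continuous_map Y euclidean f; continuous_map Y euclidean g\<rbrakk>
      \<Longrightarrow> \<Lambda> (\<lambda>y. f y + g y) = \<Lambda> f + \<Lambda> g"
    and scale: "\<And>c f. continuous_map Y euclidean f \<Longrightarrow> \<Lambda> (\<lambda>y. c * f y) = c * \<Lambda> f"
    and contraction: "\<And>f. \<lbrakk>continuous_map Y euclidean f; \<And>y. y \<in> topspace Y \<Longrightarrow> cmod (f y) \<le> 1\<rbrakk>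
      \<Longrightarrow> cmod (\<Lambda> f) \<le> 1"
    and pulled_back: "\<And>g. continuous_map X euclidean g \<Longrightarrow> \<Lambda> (\<lambda>y. g (proj y)) = g x"
    and defect: "\<And>f y. \<lbrakk>continuous_map Y euclidean f; \<And>y. y \<in> topspace Y \<Longrightarrow> cmod (f y) \<le> 1;
      y \<in> topspace Y; proj y = x\<rbrakk> \<Longrightarrow> cmod (f y - \<Lambda> f) \<le> 1"
begin

lemma constant_function: "\<Lambda> (\<lambda>y. c) = c"
  using pulled_back[of "\<lambda>_. c"] by (simp add: continuous_map_const)

lemma diff:
  assumes "continuous_map Y euclidean f" "continuous_map Y euclidean g"
  shows "\<Lambda> (\<lambda>y. f y - g y) = \<Lambda> f - \<Lambda> g"
  using add[OF assms(1), of "\<lambda>y. (- 1) * g y"] scale[OF assms(2), of "- 1"] assms(2)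
  by (simp add: continuous_map_minus)

lemma bounded:
  assumes f: "continuous_map Y euclidean f" and e: "e > 0"
    and le: "\<And>y. y \<in> topspace Y \<Longrightarrow> cmod (f y) \<le> e"
  shows "cmod (\<Lambda> f) \<le> e"
proof -
  have "cmod (\<Lambda> (\<lambda>y. of_real (1/e) * f y)) \<le> 1"
    using e le by (intro contraction continuous_map_complex_intros f) (auto simp: norm_mult norm_divide)
  then show ?thesis
    using e f by (simp only: scale norm_mult) (simp add: norm_divide field_simps)
qed

text \<open>
  A replacement for the Cauchy-Schwarz inequality that uses only the norm bound. If the value \<open>w\<close> were
  nonzero, rotating \<open>f \<cdot> (g \<circ> \<Pi>)\<close> so that its value becomes positive and adding a multiple of it to
  \<open>1 - g \<circ> \<Pi>\<close> would give a function still bounded by \<open>1\<close> on which \<open>\<Lambda>\<close> exceeds \<open>1\<close>.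
\<close>

lemma vanishing_factor:
  assumes f: "continuous_map Y euclidean f" and g: "continuous_map X euclideanreal g"
    and g01: "\<And>t. t \<in> topspace X \<Longrightarrow> 0 \<le> g t \<and> g t \<le> 1" and gx: "g x = 0"
  shows "\<Lambda> (\<lambda>y. f y * of_real (g (proj y))) = 0"
proof -
  obtain C where C: "C > 0" "\<And>y. y \<in> topspace Y \<Longrightarrow> cmod (f y) \<le> C"
    using continuous_map_compact_bounded[OF Y(1) f] by blast
  define w where "w = \<Lambda> (\<lambda>y. f y * of_real (g (proj y)))"
  \<comment> \<open>The factor that makes \<open>a * w = |w| / C\<close> real while \<open>|a f| \<le> 1\<close>.\<close>
  define a where "a = cnj (sgn w) / of_real C"
  have gp: "continuous_map Y euclidean (\<lambda>y. complex_of_real (g (proj y)))"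
    by (intro continuous_map_complex_intros continuous_map_compose[OF proj g, unfolded o_def])
  have one_gp: "continuous_map Y euclidean (\<lambda>y. 1 - complex_of_real (g (proj y)))"
    by (intro continuous_map_complex_intros gp) auto
  have fg: "continuous_map Y euclidean (\<lambda>y. f y * of_real (g (proj y)))"
    by (intro continuous_map_complex_intros f gp)
  have afg: "continuous_map Y euclidean (\<lambda>y. a * (f y * of_real (g (proj y))))"
    by (intro continuous_map_complex_intros fg) auto
  have "\<Lambda> (\<lambda>y. complex_of_real (g (proj y))) = 0"
    using pulled_back[OF continuous_map_complex_of_real[OF g]] gx by simp
  then have "\<Lambda> (\<lambda>y. 1 - complex_of_real (g (proj y))) = 1"
    by (subst diff) (auto intro!: gp simp: constant_function continuous_map_const)
  then have val: "\<Lambda> (\<lambda>y. (1 - complex_of_real (g (proj y))) + a * (f y * of_real (g (proj y))))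
      = 1 + a * w"
    by (simp add: add[OF one_gp afg] scale[OF fg] w_def)
  have "cmod (sgn w) \<le> 1" by (simp add: norm_sgn)
  then have na: "cmod a * C \<le> 1"
    using C(1) by (simp add: a_def norm_divide)
  have "cmod ((1 - complex_of_real (g (proj y))) + a * (f y * of_real (g (proj y)))) \<le> 1"
    if y: "y \<in> topspace Y" for y
  proof -
    have gy: "0 \<le> g (proj y)" "g (proj y) \<le> 1"
      using g01 y proj by (auto simp: continuous_map_def)
    have "cmod (1 - complex_of_real (g (proj y))) = 1 - g (proj y)"
      using gy by (metis abs_of_nonneg diff_ge_0_iff_ge norm_of_real of_real_1 of_real_diff)
    moreover have "cmod (a * (f y * of_real (g (proj y)))) \<le> 1 * g (proj y)"
    proof -
      have "cmod a * cmod (f y) \<le> cmod a * C"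
        using C(2)[OF y] by (intro mult_left_mono) auto
      then have "cmod a * cmod (f y) \<le> 1" using na by linarith
      then have "(cmod a * cmod (f y)) * g (proj y) \<le> 1 * g (proj y)"
        using gy by (intro mult_right_mono) auto
      then show ?thesis using gy by (simp add: norm_mult mult.assoc)
    qed
    ultimately show ?thesis
      using norm_triangle_ineq[of "1 - complex_of_real (g (proj y))" "a * (f y * of_real (g (proj y)))"]
      by linarith
  qed
  then have "cmod (1 + a * w) \<le> 1"
    using contraction[OF continuous_map_add[OF one_gp afg]] val by simp
  moreover have "a * w = of_real (cmod w / C)"
  proof (cases "w = 0")
    case False
    have "cnj (sgn w) * w = (w * cnj w) / of_real (cmod w)"
      by (simp add: sgn_eq)
    also have "\<dots> = of_real ((cmod w)\<^sup>2 / cmod w)"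
      by (simp only: complex_norm_square[symmetric] of_real_divide)
    also have "\<dots> = of_real (cmod w)"
      by (simp add: power2_eq_square)
    finally have "cnj (sgn w) * w = of_real (cmod w)" .
    then show ?thesis by (simp add: a_def)
  qed simp
  ultimately have "cmod (of_real (1 + cmod w / C)) \<le> 1"
    by (metis of_real_1 of_real_add)
  then have "cmod w / C \<le> 0"
    unfolding norm_of_real by linarith
  then have "w = 0"
    using C(1) by (simp add: divide_le_0_iff)
  then show ?thesis by (simp add: w_def)
qed

text \<open>
  A function vanishing on the fibre is at least \<open>e\<close> in modulus only on a compact set whose image misses
  \<open>x\<close>. An Urysohn function \<open>g\<close> on \<open>X\<close> equal to \<open>1\<close> on that image and \<open>0\<close> at \<open>x\<close> splits \<open>f\<close> into
  \<open>f \<cdot> (g \<circ> \<Pi>)\<close>, killed by \<open>vanishing_factor\<close>, and a remainder of norm at most \<open>e\<close>.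
\<close>

lemma supported_on_fibre:
  assumes f: "continuous_map Y euclidean f"
    and zero: "\<And>y. \<lbrakk>y \<in> topspace Y; proj y = x\<rbrakk> \<Longrightarrow> f y = 0"
  shows "\<Lambda> f = 0"
proof -
  have "cmod (\<Lambda> f) \<le> e" if e: "e > 0" for e
  proof -
    define K where "K = {y \<in> topspace Y. f y \<in> {z. e \<le> cmod z}}"
    have "closed {z::complex. e \<le> cmod z}"
      by (intro closed_Collect_le continuous_intros)
    then have "closedin Y K"
      unfolding K_def by (intro closedin_continuous_map_preimage[OF f]) simp
    then have "closedin X (proj ` K)"
      using continuous_imp_closed_map[OF proj Y(1) X(2)] by (simp add: closed_map_def)
    moreover have "closedin X {x}"
      using X(2) x by (simp add: closedin_Hausdorff_singleton)
    moreover have "disjnt {x} (proj ` K)"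
      using zero e by (auto simp: K_def disjnt_def)
    moreover have "normal_space X"
      using X compact_Hausdorff_or_regular_imp_normal_space by blast
    ultimately obtain g where g: "continuous_map X (top_of_set {0..1::real}) g"
        "g ` {x} \<subseteq> {0}" "g ` (proj ` K) \<subseteq> {1}"
      using Urysohn_lemma[of X "{x}" "proj ` K" 0 1] by auto
    have gr: "continuous_map X euclideanreal g"
      using g(1) continuous_map_in_subtopology by blast
    have g01: "0 \<le> g t \<and> g t \<le> 1" if "t \<in> topspace X" for t
      using g(1) that by (auto simp: continuous_map_in_subtopology)
    have gp: "continuous_map Y euclidean (\<lambda>y. complex_of_real (g (proj y)))"
      by (intro continuous_map_complex_intros continuous_map_compose[OF proj gr, unfolded o_def])
    have c1: "continuous_map Y euclidean (\<lambda>y. f y * of_real (g (proj y)))"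
      by (intro continuous_map_complex_intros f gp)
    have c2: "continuous_map Y euclidean (\<lambda>y. f y * (1 - of_real (g (proj y))))"
      by (intro continuous_map_complex_intros f gp) auto
    have "\<Lambda> f = \<Lambda> (\<lambda>y. f y * of_real (g (proj y)) + f y * (1 - of_real (g (proj y))))"
      by (simp add: algebra_simps)
    also have "\<dots> = \<Lambda> (\<lambda>y. f y * (1 - of_real (g (proj y))))"
      using vanishing_factor[OF f gr g01] g(2) by (simp add: add[OF c1 c2])
    finally have eq: "\<Lambda> f = \<Lambda> (\<lambda>y. f y * (1 - of_real (g (proj y))))" .
    have "cmod (f y * (1 - of_real (g (proj y)))) \<le> e" if y: "y \<in> topspace Y" for y
    proof (cases "y \<in> K")
      case True
      then have "g (proj y) = 1" using g(3) by blast
      then show ?thesis using e by simp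
    next
      case False
      then have "cmod (f y) \<le> e" using y by (simp add: K_def)
      moreover have "0 \<le> g (proj y)" "g (proj y) \<le> 1"
        using g01 y proj by (auto simp: continuous_map_def)
      then have "cmod (1 - of_real (g (proj y))) \<le> 1"
        by (metis abs_of_nonneg diff_ge_0_iff_ge diff_le_eq le_add_same_cancel1 norm_of_real of_real_1 of_real_diff)
      ultimately show ?thesis
        unfolding norm_mult using mult_mono[of "cmod (f y)" e "cmod (1 - of_real (g (proj y)))" 1] e by simp
    qed
    then show ?thesis
      unfolding eq using e by (intro bounded c2) auto
  qed
  then show ?thesis
    using dense_ge[of 0 "cmod (\<Lambda> f)"] by simp
qed

text \<open>
  In terms of the measure representing \<open>\<Lambda>\<close>, every point of the fibre has mass at least \<open>1/2\<close>. The reason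
  is that \<open>2u - 1\<close> has norm at most \<open>1\<close> and takes the value \<open>1\<close> at the point, so \<open>defect\<close> bounds
  \<open>2 - 2 \<Lambda> u\<close> by \<open>1\<close>.
\<close>

lemma half_mass:
  assumes u: "continuous_map Y euclideanreal u" and u01: "\<And>y. y \<in> topspace Y \<Longrightarrow> 0 \<le> u y \<and> u y \<le> 1"
    and y: "y \<in> topspace Y" "proj y = x" and uy: "u y = 1"
  shows "cmod (1 - \<Lambda> (\<lambda>y. of_real (u y))) \<le> 1/2"
proof -
  have cu: "continuous_map Y euclidean (\<lambda>y. complex_of_real (u y))"
    by (intro continuous_map_complex_intros u)
  have c2u: "continuous_map Y euclidean (\<lambda>y. 2 * complex_of_real (u y))"
    by (intro continuous_map_complex_intros u) auto
  have c: "continuous_map Y euclidean (\<lambda>y. 2 * complex_of_real (u y) - 1)"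
    by (intro continuous_map_complex_intros u) auto
  have "cmod (2 * complex_of_real (u z) - 1) \<le> 1" if "z \<in> topspace Y" for z
  proof -
    have "2 * complex_of_real (u z) - 1 = of_real (2 * u z - 1)" by simp
    then show ?thesis using u01[OF that] by (simp only: norm_of_real) auto
  qed
  then have "cmod ((2 * complex_of_real (u y) - 1) - \<Lambda> (\<lambda>y. 2 * complex_of_real (u y) - 1)) \<le> 1"
    by (intro defect c y) auto
  moreover have "\<Lambda> (\<lambda>y. 2 * complex_of_real (u y) - 1) = 2 * \<Lambda> (\<lambda>y. of_real (u y)) - 1"
    by (subst diff[OF c2u]) (simp_all add: scale[OF cu] constant_function continuous_map_const)
  ultimately have "cmod (2 * (1 - \<Lambda> (\<lambda>y. of_real (u y)))) \<le> 1"
    using uy by (simp add: algebra_simps)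
  then show ?thesis unfolding norm_mult by simp
qed

lemma separating_function:
  assumes "y \<in> topspace Y" "closedin Y S" "y \<notin> S"
  obtains u where "continuous_map Y euclideanreal u"
    "\<And>z. z \<in> topspace Y \<Longrightarrow> 0 \<le> u z \<and> u z \<le> 1" "u y = 1" "\<And>z. z \<in> S \<Longrightarrow> u z = 0"
proof -
  have "normal_space Y"
    using Y compact_Hausdorff_or_regular_imp_normal_space by blast
  moreover have "closedin Y {y}"
    using assms Y by (simp add: closedin_Hausdorff_singleton)
  ultimately obtain u where u: "continuous_map Y (top_of_set {0..1::real}) u"
      "u ` S \<subseteq> {0}" "u ` {y} \<subseteq> {1}"
    using Urysohn_lemma[of Y S "{y}" 0 1] assms by auto
  show ?thesis
    by (rule that[of u]) (use u in \<open>auto simp: continuous_map_in_subtopology image_subset_iff\<close>)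
qed

text \<open>
  Three points would each carry half of a total mass \<open>1\<close>: the masses are tested against a partition of
  unity adapted to the three points.
\<close>

lemma at_most_two_points:
  assumes y: "y1 \<in> topspace Y" "y2 \<in> topspace Y" "y3 \<in> topspace Y"
    and p: "proj y1 = x" "proj y2 = x" "proj y3 = x"
    and ne: "y1 \<noteq> y2" "y1 \<noteq> y3" "y2 \<noteq> y3"
  shows False
proof -
  have cl: "closedin Y {y2, y3}" "closedin Y {y3}"
    using y Y by (auto intro!: closedin_Hausdorff_finite)
  obtain u where u: "continuous_map Y euclideanreal u"
      "\<And>z. z \<in> topspace Y \<Longrightarrow> 0 \<le> u z \<and> u z \<le> 1" "u y1 = 1" "\<And>z. z \<in> {y2, y3} \<Longrightarrow> u z = 0"
    using separating_function[OF y(1) cl(1)] ne by auto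
  obtain v where v: "continuous_map Y euclideanreal v"
      "\<And>z. z \<in> topspace Y \<Longrightarrow> 0 \<le> v z \<and> v z \<le> 1" "v y2 = 1" "\<And>z. z \<in> {y3} \<Longrightarrow> v z = 0"
    using separating_function[OF y(2) cl(2)] ne by auto
  \<comment> \<open>With \<open>u\<close> these form a partition of unity, each summand being \<open>1\<close> at its own point.\<close>
  define f2 where "f2 = (\<lambda>z. (1 - u z) * v z)"
  define f3 where "f3 = (\<lambda>z. (1 - u z) * (1 - v z))"
  have c2: "continuous_map Y euclideanreal f2" and c3: "continuous_map Y euclideanreal f3"
    unfolding f2_def f3_def by (intro continuous_intros u v; simp)+
  have b2: "0 \<le> f2 z \<and> f2 z \<le> 1" and b3: "0 \<le> f3 z \<and> f3 z \<le> 1" if "z \<in> topspace Y" for z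
    unfolding f2_def f3_def using u(2)[OF that] v(2)[OF that]
    by (auto intro!: mult_le_one)
  have "\<Lambda> (\<lambda>z. of_real (u z) + (of_real (f2 z) + of_real (f3 z))) = \<Lambda> (\<lambda>z. 1)"
    by (rule arg_cong[of _ _ \<Lambda>]) (auto simp: f2_def f3_def algebra_simps)
  then have "\<Lambda> (\<lambda>z. of_real (u z)) + (\<Lambda> (\<lambda>z. of_real (f2 z)) + \<Lambda> (\<lambda>z. of_real (f3 z))) = 1"
    using u(1) c2 c3 by (simp add: add continuous_map_complex_intros constant_function)
  moreover have "cmod (1 - \<Lambda> (\<lambda>z. of_real (u z))) \<le> 1/2"
    using half_mass[OF u(1,2)] y p u by blast
  moreover have "cmod (1 - \<Lambda> (\<lambda>z. of_real (f2 z))) \<le> 1/2"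
    by (rule half_mass[OF c2 b2 y(2) p(2)]) (use u v in \<open>auto simp: f2_def\<close>)
  moreover have "cmod (1 - \<Lambda> (\<lambda>z. of_real (f3 z))) \<le> 1/2"
    by (rule half_mass[OF c3 b3 y(3) p(3)]) (use u v in \<open>auto simp: f3_def\<close>)
  moreover have "Re a + (Re b + Re c) = 1" if "a + (b + c) = 1" for a b c :: complex
    using that by (metis one_complex.sel(1) plus_complex.sel(1))
  ultimately show False
    using complex_Re_le_cmod[of "1 - \<Lambda> (\<lambda>z. of_real (u z))"]
      complex_Re_le_cmod[of "1 - \<Lambda> (\<lambda>z. of_real (f2 z))"]
      complex_Re_le_cmod[of "1 - \<Lambda> (\<lambda>z. of_real (f3 z))"]
    by fastforce
qed

text \<open>
  Over two points, complementary bumps \<open>u\<close> and \<open>1 - u\<close> each have \<open>\<Lambda>\<close>-value within \<open>1/2\<close> of \<open>1\<close>, which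
  forces both values to be \<open>1/2\<close>; subtracting the interpolant of \<open>f\<close> built from \<open>u\<close> leaves a function
  vanishing on the fibre. For a one-point fibre take \<open>z = y\<close>.
\<close>

lemma fibre_average:
  assumes y: "y \<in> topspace Y" "proj y = x"
  shows "\<exists>z. {y' \<in> topspace Y. proj y' = x} = {y, z} \<and>
    (\<forall>f. continuous_map Y euclidean f \<longrightarrow> \<Lambda> f = (f y + f z) / 2)"
proof (cases "{y' \<in> topspace Y. proj y' = x} = {y}")
  case True
  have "\<Lambda> f = f y" if f: "continuous_map Y euclidean f" for f
  proof -
    have "\<Lambda> (\<lambda>t. f t - f y) = 0"
      using True by (intro supported_on_fibre continuous_map_complex_intros f) auto
    then show ?thesis
      using diff[OF f, of "\<lambda>_. f y"] by (simp add: constant_function continuous_map_const)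
  qed
  then show ?thesis using True by (intro exI[of _ y]) auto
next
  case False
  then obtain z where z: "z \<in> topspace Y" "proj z = x" "z \<noteq> y"
    using y by blast
  have F: "{y' \<in> topspace Y. proj y' = x} = {y, z}"
    using at_most_two_points[OF y(1) z(1) _ y(2) z(2)] y z by blast
  have cl: "closedin Y {z}"
    using z Y by (simp add: closedin_Hausdorff_singleton)
  obtain u where u: "continuous_map Y euclideanreal u"
      "\<And>t. t \<in> topspace Y \<Longrightarrow> 0 \<le> u t \<and> u t \<le> 1" "u y = 1" "\<And>t. t \<in> {z} \<Longrightarrow> u t = 0"
    using separating_function[OF y(1) cl] z by auto
  have cu: "continuous_map Y euclidean (\<lambda>t. complex_of_real (u t))"
    by (intro continuous_map_complex_intros u)
  define a where "a = \<Lambda> (\<lambda>t. of_real (u t))"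
  have "cmod (1 - a) \<le> 1/2"
    unfolding a_def by (rule half_mass[OF u(1,2) y u(3)])
  moreover have "cmod (1 - \<Lambda> (\<lambda>t. of_real (1 - u t))) \<le> 1/2"
    by (rule half_mass[OF _ _ z(1,2)]) (use u in \<open>auto intro!: continuous_intros\<close>)
  moreover have "\<Lambda> (\<lambda>t. of_real (1 - u t)) = 1 - a"
    using diff[OF _ cu, of "\<lambda>_. 1"] by (simp add: a_def constant_function continuous_map_const)
  ultimately have b: "cmod (1 - a) \<le> 1/2" "cmod a \<le> 1/2" by auto
  \<comment> \<open>The discs of radius \<open>1/2\<close> about \<open>0\<close> and \<open>1\<close> touch only at \<open>1/2\<close>.\<close>
  have "a = 1/2"
  proof -
    have re: "Re a = 1/2"
      using b complex_Re_le_cmod[of a] complex_Re_le_cmod[of "1 - a"] by simp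
    have "(cmod a)\<^sup>2 \<le> (1/2)\<^sup>2" using b by (intro power_mono) auto
    then have "(Im a)\<^sup>2 \<le> 0" using re by (simp add: cmod_power2)
    then show ?thesis using re by (simp add: complex_eq_iff)
  qed
  have "\<Lambda> f = (f y + f z) / 2" if f: "continuous_map Y euclidean f" for f
  proof -
    have c1: "continuous_map Y euclidean (\<lambda>t. (f y - f z) * of_real (u t))"
      by (intro continuous_map_complex_intros u) auto
    have c2: "continuous_map Y euclidean (\<lambda>t. f t - f z)"
      by (intro continuous_map_complex_intros f) auto
    have "\<Lambda> (\<lambda>t. (f t - f z) - (f y - f z) * of_real (u t)) = 0"
    proof (rule supported_on_fibre)
      fix t assume "t \<in> topspace Y" "proj t = x"
      then have "t \<in> {y, z}" using F by blast
      then show "(f t - f z) - (f y - f z) * of_real (u t) = 0" using u by auto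
    qed (intro continuous_map_diff c1 c2)
    then have "\<Lambda> f - f z = (f y - f z) * a"
      by (simp add: diff[OF c2 c1] diff[OF f] scale[OF cu] constant_function a_def continuous_map_const)
    then show ?thesis unfolding \<open>a = 1/2\<close> by (simp add: field_simps)
  qed
  then show ?thesis using F by blast
qed

end

section \<open>The group of order two and its Haar measure\<close>

definition cyclic_group_two :: "nat monoid" where
  "cyclic_group_two = \<lparr>carrier = {0, 1}, mult = (\<lambda>s t. (s + t) mod 2), one = 0\<rparr>"

lemma cyclic_group_two_simps [simp]:
  "carrier cyclic_group_two = {0, 1}" "s \<otimes>\<^bsub>cyclic_group_two\<^esub> t = (s + t) mod 2"
  "\<one>\<^bsub>cyclic_group_two\<^esub> = 0"
  by (simp_all add: cyclic_group_two_def)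

lemma group_cyclic_group_two: "group cyclic_group_two"
  by (rule groupI) auto

lemma compact_group_cyclic_group_two:
  "compact_group cyclic_group_two (discrete_topology (carrier cyclic_group_two))"
proof -
  interpret group cyclic_group_two by (rule group_cyclic_group_two)
  have "inv\<^bsub>cyclic_group_two\<^esub> s \<in> {0, 1}" if "s \<in> {0, 1}" for s
    using inv_closed[of s] that by simp
  then show ?thesis
    by (auto simp: compact_group_def group_cyclic_group_two compact_space_discrete_topology
        simp flip: prod_topology_discrete_topology)
qed

definition uniform_measure_two :: "nat measure" where
  "uniform_measure_two = point_measure {0, 1} (\<lambda>_. ennreal (1/2))"

lemma sets_uniform_measure_two [simp]: "sets uniform_measure_two = Pow {0, 1}"
  and space_uniform_measure_two [simp]: "space uniform_measure_two = {0, 1}"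
  by (simp_all add: uniform_measure_two_def sets_point_measure space_point_measure)

lemma emeasure_uniform_measure_two:
  assumes "E \<subseteq> {0, 1}"
  shows "emeasure uniform_measure_two E = ennreal (real (card E) / 2)"
proof -
  have "emeasure uniform_measure_two E = (\<Sum>s\<in>E. ennreal (1/2))"
    using assms unfolding uniform_measure_two_def by (intro emeasure_point_measure_finite) auto
  also have "\<dots> = ennreal (\<Sum>s\<in>E. 1/2)"
    by (rule sum_ennreal) simp
  finally show ?thesis by simp
qed

lemma integral_uniform_measure_two:
  fixes f :: "nat \<Rightarrow> complex"
  shows "integrable uniform_measure_two f" "(LINT s|uniform_measure_two. f s) = (f 0 + f 1) / 2"
proof -
  show "integrable uniform_measure_two f"
    unfolding uniform_measure_two_def by (rule integrable_point_measure_finite) simp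
  show "(LINT s|uniform_measure_two. f s) = (f 0 + f 1) / 2"
    unfolding uniform_measure_two_def
    by (subst lebesgue_integral_point_measure_finite) (auto simp: scaleR_conv_of_real field_simps)
qed

lemma normalised_Haar_measure_cyclic_group_two:
  "normalised_Haar_measure cyclic_group_two (discrete_topology (carrier cyclic_group_two))
     uniform_measure_two"
  unfolding normalised_Haar_measure_def
proof (intro conjI ballI allI impI)
  show "space uniform_measure_two = carrier cyclic_group_two" by simp
  show "sets uniform_measure_two = sigma_sets (carrier cyclic_group_two)
      {U. openin (discrete_topology (carrier cyclic_group_two)) U}"
    using sigma_sets_top[of "{0, 1::nat}" "Pow {0, 1}"] sigma_algebra.sigma_sets_eq[OF sigma_algebra_Pow, of "{0, 1::nat}"]
    by (simp add: Pow_def)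
  show "emeasure uniform_measure_two (carrier cyclic_group_two) = 1"
    by (subst emeasure_uniform_measure_two) auto
next
  fix s E assume s: "s \<in> carrier cyclic_group_two" and E: "E \<in> sets uniform_measure_two"
  have img: "s <#\<^bsub>cyclic_group_two\<^esub> E = (\<lambda>t. (s + t) mod 2) ` E"
    by (auto simp: l_coset_def)
  have "inj_on (\<lambda>t. (s + t) mod 2) {0, 1}"
    using s by (auto simp: inj_on_def)
  then have "inj_on (\<lambda>t. (s + t) mod 2) E"
    by (rule inj_on_subset) (use E in simp)
  moreover have "(\<lambda>t. (s + t) mod 2) ` E \<subseteq> {0, 1}"
    by auto
  ultimately show "emeasure uniform_measure_two (s <#\<^bsub>cyclic_group_two\<^esub> E) = emeasure uniform_measure_two E"
    unfolding img using E by (simp add: emeasure_uniform_measure_two card_image)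
next
  fix E assume E: "E \<in> sets uniform_measure_two"
  show "emeasure uniform_measure_two E =
    (INF U\<in>{U. openin (discrete_topology (carrier cyclic_group_two)) U \<and> E \<subseteq> U}. emeasure uniform_measure_two U)"
    using E by (intro antisym INF_greatest INF_lower) (auto intro!: emeasure_mono)
next
  fix U assume U: "openin (discrete_topology (carrier cyclic_group_two)) U"
  show "emeasure uniform_measure_two U =
    (SUP K\<in>{K. compactin (discrete_topology (carrier cyclic_group_two)) K \<and> K \<subseteq> U}. emeasure uniform_measure_two K)"
    using U finite_subset[of U "{0, 1}"]
    by (intro antisym SUP_least SUP_upper) (auto intro!: emeasure_mono simp: compactin_discrete_topology)
qed

lemma continuous_action_of_involution:
  assumes \<sigma>: "continuous_map Y Y \<sigma>" and inv: "\<And>y. y \<in> topspace Y \<Longrightarrow> \<sigma> (\<sigma> y) = y"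
  shows "continuous_action cyclic_group_two (discrete_topology (carrier cyclic_group_two)) Y
    (\<lambda>s. \<lambda>y\<in>topspace Y. if s = 0 then y else \<sigma> y)" (is "continuous_action _ _ _ ?\<phi>")
proof -
  have in_Y: "\<sigma> y \<in> topspace Y" if "y \<in> topspace Y" for y
    using \<sigma> that by (auto simp: continuous_map_def)
  have Bij: "?\<phi> s \<in> Bij (topspace Y)" for s
  proof -
    have "bij_betw \<sigma> (topspace Y) (topspace Y)"
      by (rule bij_betw_byWitness[of _ \<sigma>]) (auto simp: inv in_Y)
    then have "bij_betw (\<lambda>y. if s = 0 then y else \<sigma> y) (topspace Y) (topspace Y)"
      by (cases "s = 0") (simp_all add: bij_betw_def)
    then show ?thesis by (simp add: Bij_def)
  qed
  have mult: "?\<phi> ((s + t) mod 2) = compose (topspace Y) (?\<phi> s) (?\<phi> t)"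
    if "s \<in> {0, 1}" "t \<in> {0, 1}" for s t :: nat
    using that by (auto simp: compose_def fun_eq_iff inv in_Y)
  have "?\<phi> (s \<otimes>\<^bsub>cyclic_group_two\<^esub> t) = ?\<phi> s \<otimes>\<^bsub>BijGroup (topspace Y)\<^esub> ?\<phi> t"
    if "s \<in> carrier cyclic_group_two" "t \<in> carrier cyclic_group_two" for s t
    using mult[of s t] that Bij[of s] Bij[of t] by (simp only: BijGroup_def) simp
  moreover have "?\<phi> s \<in> carrier (BijGroup (topspace Y))" for s
    using Bij[of s] by (simp only: BijGroup_def) simp
  ultimately have "?\<phi> \<in> hom cyclic_group_two (BijGroup (topspace Y))"
    by (intro homI) blast+
  then have "group_hom cyclic_group_two (BijGroup (topspace Y)) ?\<phi>"
    by (intro group_hom.intro group_cyclic_group_two group_BijGroup group_hom_axioms.intro)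
  then have "group_action cyclic_group_two (topspace Y) ?\<phi>"
    by (simp add: group_action_def)
  moreover have "continuous_map (prod_topology (discrete_topology {0, 1}) Y) Y (\<lambda>(s, y). ?\<phi> s y)"
    unfolding continuous_map_def
  proof (intro conjI allI impI)
    show "(\<lambda>(s, y). ?\<phi> s y) \<in> topspace (prod_topology (discrete_topology {0, 1}) Y) \<rightarrow> topspace Y"
      using in_Y by auto
    fix W assume W: "openin Y W"
    have "{p \<in> topspace (prod_topology (discrete_topology {0, 1}) Y). (case p of (s, y) \<Rightarrow> ?\<phi> s y) \<in> W}
      = {0::nat} \<times> W \<union> {1} \<times> {y \<in> topspace Y. \<sigma> y \<in> W}"
      using openin_subset[OF W] by (auto split: if_splits)
    moreover have "openin (prod_topology (discrete_topology {0, 1}) Y)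
        ({0::nat} \<times> W \<union> {1} \<times> {y \<in> topspace Y. \<sigma> y \<in> W})"
      using W openin_continuous_map_preimage[OF \<sigma> W]
      by (intro openin_Un) (auto simp: openin_prod_Times_iff)
    ultimately show "openin (prod_topology (discrete_topology {0, 1}) Y)
      {p \<in> topspace (prod_topology (discrete_topology {0, 1}) Y). (case p of (s, y) \<Rightarrow> ?\<phi> s y) \<in> W}"
      by simp
  qed
  ultimately show ?thesis
    by (simp add: continuous_action_def)
qed

section \<open>From the extension to a continuous involution\<close>

lemma cmod_le_one_of_op_norm:
  assumes X: "topspace X \<noteq> {}" and Y: "compact_space Y" and S: "op_norm X Y S = 1"
    and f: "f \<in> C_set X" "\<And>x. x \<in> topspace X \<Longrightarrow> cmod (f x) \<le> 1"
    and Sf: "S f \<in> C_set Y" and y: "y \<in> topspace Y"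
  shows "cmod (S f y) \<le> 1"
proof -
  have "sup_norm X f \<le> 1"
    unfolding sup_norm_def using X f by (intro cSUP_least) auto
  then have "ereal (sup_norm Y (S f)) \<le> op_norm X Y S"
    unfolding op_norm_def using f by (intro SUP_upper) auto
  then have le: "sup_norm Y (S f) \<le> 1"
    using S by (simp add: one_ereal_def)
  have "continuous_map Y euclidean (S f)" using Sf by (simp add: C_set_def)
  then obtain C where C: "\<And>y. y \<in> topspace Y \<Longrightarrow> cmod (S f y) \<le> C"
    using continuous_map_compact_bounded[OF Y] by metis
  then have "bdd_above ((\<lambda>y. cmod (S f y)) ` topspace Y)"
    by (auto simp: bdd_above_def)
  then have "cmod (S f y) \<le> sup_norm Y (S f)"
    unfolding sup_norm_def using y by (intro cSUP_upper) auto
  then show ?thesis using le by linarith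
qed

lemma restrict_in_C_set: "continuous_map X euclidean f \<Longrightarrow> restrict f (topspace X) \<in> C_set X"
  by (simp add: C_set_def)

lemma C_set_continuous: "f \<in> C_set X \<Longrightarrow> continuous_map X euclidean f"
  by (simp add: C_set_def)

lemma restrict_C_set: "f \<in> C_set X \<Longrightarrow> restrict f (topspace X) = f"
  by (simp add: C_set_def extensional_restrict)

lemma fibre_functional_of_extension:
  assumes X: "topspace X \<noteq> {}" "compact_space X" "Hausdorff_space X"
    and Y: "topspace Y \<noteq> {}" "compact_space Y" "Hausdorff_space Y"
    and ext: "generalised_Cole_extension X A Y B proj T"
    and norm: "op_norm Y Y (\<lambda>f. \<lambda>y\<in>topspace Y. f y - pullback Y proj (T f) y) = 1"
    and x: "x \<in> topspace X"
  shows "fibre_functional X Y proj x (\<lambda>f. T (restrict f (topspace Y)) x)"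
proof -
  have proj: "continuous_map Y X proj" and lin: "complex_linear_on_C Y X T"
    and T1: "op_norm Y X T = 1"
    and Tp: "\<And>f. f \<in> C_set X \<Longrightarrow> T (pullback Y proj f) = f"
    using ext by (auto simp: generalised_Cole_extension_def)
  have T_C: "T f \<in> C_set X" if "f \<in> C_set Y" for f
    using lin that by (auto simp: complex_linear_on_C_def)
  show ?thesis
  proof
    show "compact_space X" "Hausdorff_space X" "compact_space Y" "Hausdorff_space Y"
      "continuous_map Y X proj" "x \<in> topspace X"
      by fact+
  next
    fix f g :: "'b \<Rightarrow> complex" assume fg: "continuous_map Y euclidean f" "continuous_map Y euclidean g"
    have "T (\<lambda>y\<in>topspace Y. restrict f (topspace Y) y + restrict g (topspace Y) y)
      = (\<lambda>x\<in>topspace X. T (restrict f (topspace Y)) x + T (restrict g (topspace Y)) x)"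
      using lin fg[THEN restrict_in_C_set] unfolding complex_linear_on_C_def by blast
    moreover have "(\<lambda>y\<in>topspace Y. restrict f (topspace Y) y + restrict g (topspace Y) y)
      = (\<lambda>y\<in>topspace Y. f y + g y)"
      by auto
    ultimately show "T (\<lambda>y\<in>topspace Y. f y + g y) x
      = T (restrict f (topspace Y)) x + T (restrict g (topspace Y)) x"
      using x by simp
  next
    fix c and f :: "'b \<Rightarrow> complex" assume f: "continuous_map Y euclidean f"
    have "T (\<lambda>y\<in>topspace Y. c * restrict f (topspace Y) y)
      = (\<lambda>x\<in>topspace X. c * T (restrict f (topspace Y)) x)"
      using lin restrict_in_C_set[OF f] unfolding complex_linear_on_C_def by blast
    moreover have "(\<lambda>y\<in>topspace Y. c * restrict f (topspace Y) y) = (\<lambda>y\<in>topspace Y. c * f y)"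
      by auto
    ultimately show "T (\<lambda>y\<in>topspace Y. c * f y) x = c * T (restrict f (topspace Y)) x"
      using x by simp
  next
    fix f :: "'b \<Rightarrow> complex"
    assume f: "continuous_map Y euclidean f" "\<And>y. y \<in> topspace Y \<Longrightarrow> cmod (f y) \<le> 1"
    then show "cmod (T (restrict f (topspace Y)) x) \<le> 1"
      by (intro cmod_le_one_of_op_norm[OF Y(1) X(2) T1] restrict_in_C_set T_C x) auto
  next
    fix g :: "'a \<Rightarrow> complex" assume g: "continuous_map X euclidean g"
    have "(\<lambda>y\<in>topspace Y. g (proj y)) = pullback Y proj (restrict g (topspace X))"
      using continuous_map_image_subset_topspace[OF proj] by (auto simp: pullback_def fun_eq_iff)
    then show "T (\<lambda>y\<in>topspace Y. g (proj y)) x = g x"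
      using Tp[OF restrict_in_C_set[OF g]] x by simp
  next
    fix f :: "'b \<Rightarrow> complex" and y
    assume f: "continuous_map Y euclidean f" "\<And>y. y \<in> topspace Y \<Longrightarrow> cmod (f y) \<le> 1"
      and y: "y \<in> topspace Y" "proj y = x"
    let ?f = "restrict f (topspace Y)"
    let ?D = "\<lambda>f. \<lambda>y\<in>topspace Y. f y - pullback Y proj (T f) y"
    have "continuous_map Y euclidean (\<lambda>y. T ?f (proj y))"
      using continuous_map_compose[OF proj C_set_continuous[OF T_C[OF restrict_in_C_set[OF f(1)]]]]
      by (simp add: o_def)
    then have "(\<lambda>y\<in>topspace Y. f y - T ?f (proj y)) \<in> C_set Y"
      by (intro restrict_in_C_set continuous_map_diff f)
    also have "(\<lambda>y\<in>topspace Y. f y - T ?f (proj y)) = ?D ?f"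
      by (auto simp: pullback_def)
    finally have D_C: "?D ?f \<in> C_set Y" .
    have "cmod (?D ?f y) \<le> 1"
      by (rule cmod_le_one_of_op_norm[of Y Y ?D ?f y, OF Y(1,2) norm restrict_in_C_set[OF f(1)] _ D_C y(1)])
        (simp add: f(2))
    then show "cmod (f y - T ?f x) \<le> 1"
      using y by (simp add: pullback_def)
  qed
qed

text \<open>
  Urysohn's lemma says that a compact Hausdorff space carries the weak topology of its continuous real
  functions, so continuity into it can be tested on them.
\<close>

lemma continuous_map_into_compact_Hausdorff:
  assumes Y: "compact_space Y" "Hausdorff_space Y"
    and into: "\<And>z. z \<in> topspace Z \<Longrightarrow> \<sigma> z \<in> topspace Y"
    and cont: "\<And>f. continuous_map Y euclideanreal f \<Longrightarrow> continuous_map Z euclideanreal (\<lambda>z. f (\<sigma> z))"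
  shows "continuous_map Z Y \<sigma>"
  unfolding continuous_map_def
proof (intro conjI allI impI)
  show "\<sigma> \<in> topspace Z \<rightarrow> topspace Y" using into by auto
  fix U assume U: "openin Y U"
  show "openin Z {z \<in> topspace Z. \<sigma> z \<in> U}"
  proof (subst openin_subopen, intro ballI)
    fix z assume "z \<in> {z \<in> topspace Z. \<sigma> z \<in> U}"
    then have z: "z \<in> topspace Z" "\<sigma> z \<in> U" by auto
    have "normal_space Y"
      using Y compact_Hausdorff_or_regular_imp_normal_space by blast
    moreover have "closedin Y {\<sigma> z}" "closedin Y (topspace Y - U)"
      using z U Y into by (auto simp: closedin_Hausdorff_singleton)
    moreover have "disjnt {\<sigma> z} (topspace Y - U)"
      using z by (auto simp: disjnt_def)
    ultimately obtain f where f: "continuous_map Y euclideanreal f"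
        "f ` {\<sigma> z} \<subseteq> {1}" "f ` (topspace Y - U) \<subseteq> {0}"
      using Urysohn_lemma_alt by metis
    have "openin Z {t \<in> topspace Z. f (\<sigma> t) \<in> {0<..}}"
      by (rule openin_continuous_map_preimage[OF cont[OF f(1)]]) simp
    moreover have "{t \<in> topspace Z. f (\<sigma> t) \<in> {0<..}} \<subseteq> {z \<in> topspace Z. \<sigma> z \<in> U}"
      using f(3) into by (auto simp: image_subset_iff) force
    ultimately show "\<exists>V. openin Z V \<and> z \<in> V \<and> V \<subseteq> {z \<in> topspace Z. \<sigma> z \<in> U}"
      using z f(2) by (intro exI[of _ "{t \<in> topspace Z. f (\<sigma> t) \<in> {0<..}}"]) auto
  qed
qed

text \<open>
  Let \<open>\<sigma>\<close> exchange the points of each two-point fibre and fix the one-point fibres. The averaging formula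
  gives \<open>f \<circ> \<sigma> = 2 (T f \<circ> \<Pi>) - f\<close>, which is continuous for every continuous \<open>f\<close>; hence so is \<open>\<sigma>\<close>.
\<close>

lemma fibre_involution:
  assumes X: "topspace X \<noteq> {}" "compact_space X" "Hausdorff_space X"
    and Y: "topspace Y \<noteq> {}" "compact_space Y" "Hausdorff_space Y"
    and ext: "generalised_Cole_extension X A Y B proj T"
    and norm: "op_norm Y Y (\<lambda>f. \<lambda>y\<in>topspace Y. f y - pullback Y proj (T f) y) = 1"
  obtains \<sigma> where "continuous_map Y Y \<sigma>" "\<And>y. y \<in> topspace Y \<Longrightarrow> \<sigma> (\<sigma> y) = y"
    "\<And>y. y \<in> topspace Y \<Longrightarrow> {y' \<in> topspace Y. proj y' = proj y} = {y, \<sigma> y}"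
    "\<And>f y. \<lbrakk>f \<in> C_set Y; y \<in> topspace Y\<rbrakk> \<Longrightarrow> T f (proj y) = (f y + f (\<sigma> y)) / 2"
proof -
  have proj: "continuous_map Y X proj" and lin: "complex_linear_on_C Y X T"
    using ext by (auto simp: generalised_Cole_extension_def)
  have "\<exists>z. {y' \<in> topspace Y. proj y' = proj y} = {y, z} \<and>
      (\<forall>f\<in>C_set Y. T f (proj y) = (f y + f z) / 2)" if y: "y \<in> topspace Y" for y
  proof -
    have "proj y \<in> topspace X" using proj y by (auto simp: continuous_map_def)
    from fibre_functional.fibre_average[OF fibre_functional_of_extension[OF X Y ext norm this] y refl]
    obtain z where z: "{y' \<in> topspace Y. proj y' = proj y} = {y, z}"
      "\<And>f. continuous_map Y euclidean f \<Longrightarrow> T (restrict f (topspace Y)) (proj y) = (f y + f z) / 2"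
      by blast
    show ?thesis
      by (intro exI[of _ z] conjI ballI z(1))
        (use z(2)[OF C_set_continuous] in \<open>simp add: restrict_C_set\<close>)
  qed
  then have "\<exists>\<sigma>. \<forall>y\<in>topspace Y. {y' \<in> topspace Y. proj y' = proj y} = {y, \<sigma> y} \<and>
      (\<forall>f\<in>C_set Y. T f (proj y) = (f y + f (\<sigma> y)) / 2)"
    by (intro bchoice) blast
  then obtain \<sigma> where fibre: "\<And>y. y \<in> topspace Y \<Longrightarrow> {y' \<in> topspace Y. proj y' = proj y} = {y, \<sigma> y}"
    and avg: "\<And>f y. \<lbrakk>f \<in> C_set Y; y \<in> topspace Y\<rbrakk> \<Longrightarrow> T f (proj y) = (f y + f (\<sigma> y)) / 2"
    by blast
  have in_Y: "\<sigma> y \<in> topspace Y" "proj (\<sigma> y) = proj y" if "y \<in> topspace Y" for y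
    using fibre[OF that] by blast+
  have "{y, \<sigma> y} = {\<sigma> y, \<sigma> (\<sigma> y)}" if "y \<in> topspace Y" for y
    using fibre[OF that] fibre[OF in_Y(1)[OF that]] in_Y[OF that] by simp
  then have inv: "\<sigma> (\<sigma> y) = y" if "y \<in> topspace Y" for y
    using that by (metis doubleton_eq_iff)
  have "continuous_map Y Y \<sigma>"
  proof (rule continuous_map_into_compact_Hausdorff[OF Y(2,3) in_Y(1)])
    fix f :: "'b \<Rightarrow> real" assume f: "continuous_map Y euclideanreal f"
    let ?f = "\<lambda>y\<in>topspace Y. complex_of_real (f y)"
    have fC: "?f \<in> C_set Y"
      by (intro restrict_in_C_set continuous_map_complex_intros f)
    then have "T ?f \<in> C_set X" using lin by (auto simp: complex_linear_on_C_def)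
    then have "continuous_map Y euclidean (\<lambda>y. T ?f (proj y))"
      using continuous_map_compose[OF proj C_set_continuous] by (simp add: o_def)
    then have "continuous_map Y euclideanreal (\<lambda>y. 2 * Re (T ?f (proj y)) - f y)"
      using f by (simp add: continuous_map_atin tendsto_diff tendsto_mult_left tendsto_Re)
    moreover have "2 * Re (T ?f (proj y)) - f y = f (\<sigma> y)" if "y \<in> topspace Y" for y
      using arg_cong[OF avg[OF fC that], of Re] in_Y[OF that] that by simp
    ultimately show "continuous_map Y euclideanreal (\<lambda>y. f (\<sigma> y))"
      by (rule continuous_map_eq)
  qed
  then show ?thesis using that inv fibre avg by blast
qed

lemma implemented_by_involution:
  assumes "continuous_map Y Y \<sigma>" "\<And>y. y \<in> topspace Y \<Longrightarrow> \<sigma> (\<sigma> y) = y"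
    and fibre: "\<And>y. y \<in> topspace Y \<Longrightarrow> {y' \<in> topspace Y. proj y' = proj y} = {y, \<sigma> y}"
    and avg: "\<And>f y. \<lbrakk>f \<in> B; y \<in> topspace Y\<rbrakk> \<Longrightarrow> T f (proj y) = (f y + f (\<sigma> y)) / 2"
  shows "implemented_by X Y B proj T cyclic_group_two (discrete_topology (carrier cyclic_group_two))"
proof -
  let ?\<phi> = "\<lambda>s::nat. \<lambda>y\<in>topspace Y. if s = 0 then y else \<sigma> y"
  have "orbit cyclic_group_two ?\<phi> y = {y' \<in> topspace Y. proj y' = proj y}" if "y \<in> topspace Y" for y
    using that fibre by (auto simp: orbit_def)
  moreover have "T f (proj y) = (LINT s|uniform_measure_two. f (?\<phi> s y))"
    if "f \<in> B" "y \<in> topspace Y" for f y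
    using that avg by (simp add: integral_uniform_measure_two)
  ultimately show ?thesis
    unfolding implemented_by_def
    by (intro conjI exI[of _ ?\<phi>] exI[of _ uniform_measure_two] ballI
        compact_group_cyclic_group_two continuous_action_of_involution[OF assms(1,2)]
        normalised_Haar_measure_cyclic_group_two integral_uniform_measure_two(1)) auto
qed

section \<open>Generated uniform algebras and homeomorphisms\<close>

lemma uniform_closure_of_iff:
  assumes X: "topspace X \<noteq> {}" "compact_space X"
  shows "f \<in> uniform_closure_of X S \<longleftrightarrow>
    f \<in> C_set X \<and> (\<forall>e>0. \<exists>g\<in>S \<inter> C_set X. \<forall>x\<in>topspace X. cmod (f x - g x) \<le> e)"
proof -
  let ?M = "cfunspace X (euclidean_metric :: complex metric)"
  interpret M: Metric_space "mspace ?M" "mdist ?M" by (rule Metric_space_mspace_mdist)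
  have sp: "mspace ?M = C_set X" by (rule mspace_cfunspace_eq_C_set[OF X(2)])
  have d: "mdist ?M f g \<le> e \<longleftrightarrow> (\<forall>x\<in>topspace X. cmod (f x - g x) \<le> e)"
    if "f \<in> C_set X" "g \<in> C_set X" for f g e
    using cfunspace_mdist_le[of f X "euclidean_metric :: complex metric" g e] that X
    unfolding sp by (simp add: dist_norm)
  have "f \<in> uniform_closure_of X S \<longleftrightarrow> f \<in> C_set X \<and> (\<forall>r>0. \<exists>g\<in>S. g \<in> M.mcball f r)"
    by (simp only: mtopology_of_def M.metric_closure_of_alt mem_Collect_eq) (simp only: sp)
  also have "\<dots> \<longleftrightarrow>
      f \<in> C_set X \<and> (\<forall>e>0. \<exists>g\<in>S \<inter> C_set X. \<forall>x\<in>topspace X. cmod (f x - g x) \<le> e)"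
  proof (rule conj_cong[OF refl])
    assume f: "f \<in> C_set X"
    have "g \<in> M.mcball f r \<longleftrightarrow> g \<in> C_set X \<and> (\<forall>x\<in>topspace X. cmod (f x - g x) \<le> r)" for g r
      using f d[OF f, of g r] by (simp only: M.in_mcball) (simp only: sp, blast)
    then show "(\<forall>r>0. \<exists>g\<in>S. g \<in> M.mcball f r) \<longleftrightarrow>
        (\<forall>e>0. \<exists>g\<in>S \<inter> C_set X. \<forall>x\<in>topspace X. cmod (f x - g x) \<le> e)"
      by (simp only: Bex_def Int_iff conj_assoc)
  qed
  finally show ?thesis .
qed

lemma pullback_in_C_set:
  assumes "continuous_map Y Z \<psi>" "f \<in> C_set Z"
  shows "pullback Y \<psi> f \<in> C_set Y"
  unfolding pullback_def
  using continuous_map_compose[OF assms(1) C_set_continuous[OF assms(2)]]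
  by (intro restrict_in_C_set) (simp add: o_def)

lemma unital_subalgebra_C_set: "unital_subalgebra X (C_set X)"
  unfolding unital_subalgebra_def
  by (auto intro!: restrict_in_C_set continuous_map_complex_intros dest: C_set_continuous)

text \<open>
  Subalgebras are required to lie in \<open>C(X)\<close>, so the intersection defining the hull must range over at
  least one set; \<open>S \<subseteq> C(X)\<close> provides one, namely \<open>C(X)\<close>.
\<close>

lemma unital_subalgebra_hull:
  assumes "S \<subseteq> C_set X"
  shows "unital_subalgebra X (unital_subalgebra X hull S)"
  using assms unital_subalgebra_C_set[of X]
  unfolding hull_def unital_subalgebra_def by auto

lemma unital_subalgebra_preimage:
  assumes \<psi>: "continuous_map Y Z \<psi>" and N: "unital_subalgebra Y N"
  shows "unital_subalgebra Z {f \<in> C_set Z. pullback Y \<psi> f \<in> N}"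
proof -
  have in_Z: "\<psi> y \<in> topspace Z" if "y \<in> topspace Y" for y
    using \<psi> that by (auto simp: continuous_map_def)
  have eqs: "pullback Y \<psi> (\<lambda>x\<in>topspace Z. c) = (\<lambda>y\<in>topspace Y. c)"
    "pullback Y \<psi> (\<lambda>x\<in>topspace Z. f x + g x) = (\<lambda>y\<in>topspace Y. pullback Y \<psi> f y + pullback Y \<psi> g y)"
    "pullback Y \<psi> (\<lambda>x\<in>topspace Z. f x * g x) = (\<lambda>y\<in>topspace Y. pullback Y \<psi> f y * pullback Y \<psi> g y)"
    "pullback Y \<psi> (\<lambda>x\<in>topspace Z. c * f x) = (\<lambda>y\<in>topspace Y. c * pullback Y \<psi> f y)" for c f g
    by (auto simp: pullback_def in_Z fun_eq_iff)
  show ?thesis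
    using N unital_subalgebra_C_set[of Z] unfolding unital_subalgebra_def
    by (simp add: eqs(1,2,4)) (simp add: eqs(3))
qed

text \<open>
  Composition with \<open>\<psi>\<close> is a norm-decreasing homomorphism. On the algebraic hull the inclusion follows
  from minimality, as the preimage of a subalgebra is a subalgebra; uniform approximations pull back.
\<close>

lemma pullback_generated_uniform_algebra_subset:
  assumes Y: "topspace Y \<noteq> {}" "compact_space Y" and Z: "topspace Z \<noteq> {}" "compact_space Z"
    and \<psi>: "continuous_map Y Z \<psi>" and S: "S \<subseteq> C_set Z"
  shows "pullback Y \<psi> ` generated_uniform_algebra Z S \<subseteq> generated_uniform_algebra Y (pullback Y \<psi> ` S)"
proof -
  have "pullback Y \<psi> ` S \<subseteq> C_set Y"
    using S pullback_in_C_set[OF \<psi>] by auto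
  then have "unital_subalgebra Z
      {f \<in> C_set Z. pullback Y \<psi> f \<in> unital_subalgebra Y hull (pullback Y \<psi> ` S)}"
    by (intro unital_subalgebra_preimage[OF \<psi>] unital_subalgebra_hull)
  moreover have "S \<subseteq> {f \<in> C_set Z. pullback Y \<psi> f \<in> unital_subalgebra Y hull (pullback Y \<psi> ` S)}"
    using S hull_subset[of "pullback Y \<psi> ` S" "unital_subalgebra Y"] by blast
  ultimately have hull: "pullback Y \<psi> g \<in> unital_subalgebra Y hull (pullback Y \<psi> ` S)"
    if "g \<in> unital_subalgebra Z hull S" for g
    using that hull_minimal by blast
  show ?thesis
  proof safe
    fix f assume "f \<in> generated_uniform_algebra Z S"
    then have f: "f \<in> C_set Z" and
      approx: "\<And>e. e > 0 \<Longrightarrow> \<exists>g\<in>(unital_subalgebra Z hull S) \<inter> C_set Z. \<forall>x\<in>topspace Z. cmod (f x - g x) \<le> e"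
      by (auto simp: generated_uniform_algebra_def uniform_closure_of_iff[OF Z])
    show "pullback Y \<psi> f \<in> generated_uniform_algebra Y (pullback Y \<psi> ` S)"
      unfolding generated_uniform_algebra_def uniform_closure_of_iff[OF Y]
    proof (intro conjI allI impI pullback_in_C_set[OF \<psi> f])
      fix e :: real assume "e > 0"
      then obtain g where g: "g \<in> unital_subalgebra Z hull S" "g \<in> C_set Z"
          "\<And>x. x \<in> topspace Z \<Longrightarrow> cmod (f x - g x) \<le> e"
        using approx by blast
      have "cmod (pullback Y \<psi> f y - pullback Y \<psi> g y) \<le> e" if "y \<in> topspace Y" for y
        using g(3)[of "\<psi> y"] that \<psi> by (auto simp: pullback_def continuous_map_def)
      then show "\<exists>k\<in>(unital_subalgebra Y hull (pullback Y \<psi> ` S)) \<inter> C_set Y.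
          \<forall>y\<in>topspace Y. cmod (pullback Y \<psi> f y - k y) \<le> e"
        using hull[OF g(1)] pullback_in_C_set[OF \<psi> g(2)] by blast
    qed
  qed
qed

text \<open>
  For a homeomorphism the inclusion for the inverse map yields the converse.
\<close>

lemma pullback_generated_uniform_algebra:
  assumes Y: "topspace Y \<noteq> {}" "compact_space Y" and Z: "topspace Z \<noteq> {}" "compact_space Z"
    and \<psi>: "homeomorphic_map Y Z \<psi>" and S: "S \<subseteq> C_set Z"
  shows "pullback Y \<psi> ` generated_uniform_algebra Z S = generated_uniform_algebra Y (pullback Y \<psi> ` S)"
proof (rule antisym)
  obtain \<phi> where "homeomorphic_maps Y Z \<psi> \<phi>"
    using \<psi> homeomorphic_map_maps by blast
  then have c: "continuous_map Y Z \<psi>" "continuous_map Z Y \<phi>"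
    and inv: "\<And>y. y \<in> topspace Y \<Longrightarrow> \<phi> (\<psi> y) = y" "\<And>z. z \<in> topspace Z \<Longrightarrow> \<psi> (\<phi> z) = z"
    by (auto simp: homeomorphic_maps_def)
  have in_sp: "\<And>y. y \<in> topspace Y \<Longrightarrow> \<psi> y \<in> topspace Z" "\<And>z. z \<in> topspace Z \<Longrightarrow> \<phi> z \<in> topspace Y"
    using c by (auto simp: continuous_map_def)
  show "pullback Y \<psi> ` generated_uniform_algebra Z S \<subseteq> generated_uniform_algebra Y (pullback Y \<psi> ` S)"
    by (rule pullback_generated_uniform_algebra_subset[OF Y Z c(1) S])
  have retract: "pullback Z \<phi> (pullback Y \<psi> f) = f" if "f \<in> C_set Z" for f
    using that in_sp inv by (auto simp: pullback_def C_set_def extensional_def fun_eq_iff)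
  have S': "pullback Y \<psi> ` S \<subseteq> C_set Y"
    using S pullback_in_C_set[OF c(1)] by auto
  have "pullback Z \<phi> ` pullback Y \<psi> ` S = S"
    using retract S by (force simp: image_image subset_iff)
  then have sub: "pullback Z \<phi> ` generated_uniform_algebra Y (pullback Y \<psi> ` S) \<subseteq> generated_uniform_algebra Z S"
    using pullback_generated_uniform_algebra_subset[OF Z Y c(2) S'] by simp
  show "generated_uniform_algebra Y (pullback Y \<psi> ` S) \<subseteq> pullback Y \<psi> ` generated_uniform_algebra Z S"
  proof
    fix f assume f: "f \<in> generated_uniform_algebra Y (pullback Y \<psi> ` S)"
    then have "f \<in> C_set Y"
      by (simp add: generated_uniform_algebra_def uniform_closure_of_iff[OF Y])
    then have "f = pullback Y \<psi> (pullback Z \<phi> f)"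
      using in_sp inv by (auto simp: pullback_def C_set_def extensional_def fun_eq_iff)
    then show "f \<in> pullback Y \<psi> ` generated_uniform_algebra Z S"
      using sub f by blast
  qed
qed

text \<open>
  Used contrapositively: a generating set of an algebra that separates points separates points itself.
\<close>

lemma generated_uniform_algebra_eq_at:
  assumes Y: "topspace Y \<noteq> {}" "compact_space Y" and S: "S \<subseteq> C_set Y"
    and y: "y \<in> topspace Y" "y' \<in> topspace Y" and eq: "\<And>f. f \<in> S \<Longrightarrow> f y = f y'"
    and f: "f \<in> generated_uniform_algebra Y S"
  shows "f y = f y'"
proof -
  have "unital_subalgebra Y {g \<in> C_set Y. g y = g y'}"
    using unital_subalgebra_C_set[of Y] y unfolding unital_subalgebra_def by simp
  then have "unital_subalgebra Y hull S \<subseteq> {g \<in> C_set Y. g y = g y'}"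
    using S eq by (intro hull_minimal) auto
  then have hull: "g y = g y'" if "g \<in> unital_subalgebra Y hull S" for g
    using that by blast
  have "cmod (f y - f y') \<le> e" if "e > 0" for e
  proof -
    obtain g where g: "g \<in> unital_subalgebra Y hull S" "\<And>z. z \<in> topspace Y \<Longrightarrow> cmod (f z - g z) \<le> e/2"
      using f half_gt_zero[OF \<open>e > 0\<close>]
      unfolding generated_uniform_algebra_def uniform_closure_of_iff[OF Y] by blast
    then show ?thesis
      using norm_triangle_ineq4[of "f y - g y" "f y' - g y'"] g(2)[OF y(1)] g(2)[OF y(2)] hull[OF g(1)]
      by simp
  qed
  then show ?thesis
    using dense_ge[of 0 "cmod (f y - f y')"] by simp
qed

section \<open>Square-root extensions\<close>

text \<open>
  The two points of \<open>X\<^sup>q\<close> over \<open>x\<close> are the two square roots of \<open>h x\<close>. As \<open>h0\<close> is odd under \<open>\<sigma>\<close>, it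
  takes both of them on the fibre, so \<open>(\<Pi>, h0)\<close> is onto; a continuous bijection from a compact space to
  a Hausdorff space is a homeomorphism.
\<close>

lemma homeomorphic_map_onto_sqrt_space:
  assumes X: "Hausdorff_space X" and Y: "compact_space Y"
    and proj: "continuous_map Y X proj" "proj ` topspace Y = topspace X"
    and h0: "continuous_map Y euclidean h0"
    and square: "\<And>y. y \<in> topspace Y \<Longrightarrow> h (proj y) = (h0 y)\<^sup>2"
    and \<sigma>: "\<And>y. y \<in> topspace Y \<Longrightarrow> \<sigma> y \<in> topspace Y"
      "\<And>y. y \<in> topspace Y \<Longrightarrow> proj (\<sigma> y) = proj y" "\<And>y. y \<in> topspace Y \<Longrightarrow> h0 (\<sigma> y) = - h0 y"
    and inj: "\<And>y y'. \<lbrakk>y \<in> topspace Y; y' \<in> topspace Y; proj y = proj y'; h0 y = h0 y'\<rbrakk> \<Longrightarrow> y = y'"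
  shows "homeomorphic_map Y (sqrt_space X h) (\<lambda>y. (proj y, h0 y))"
proof (rule continuous_imp_homeomorphic_map[OF _ Y])
  show "Hausdorff_space (sqrt_space X h)"
    unfolding sqrt_space_def
    by (intro Hausdorff_space_subtopology) (simp add: Hausdorff_space_prod_topology X)
  show "continuous_map Y (sqrt_space X h) (\<lambda>y. (proj y, h0 y))"
    unfolding sqrt_space_def
    using proj square by (auto simp: continuous_map_in_subtopology continuous_map_pairwise o_def h0)
  show "(\<lambda>y. (proj y, h0 y)) ` topspace Y = topspace (sqrt_space X h)"
  proof (intro equalityI subsetI)
    fix p assume "p \<in> (\<lambda>y. (proj y, h0 y)) ` topspace Y"
    then show "p \<in> topspace (sqrt_space X h)"
      using proj(2) square by (auto simp: sqrt_space_def)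
  next
    fix p assume "p \<in> topspace (sqrt_space X h)"
    moreover obtain x z where "p = (x, z)" by (cases p)
    ultimately have p: "p = (x, z)" "x \<in> topspace X" "z\<^sup>2 = h x"
      by (simp_all add: sqrt_space_def)
    have "x \<in> proj ` topspace Y"
      using proj(2) p(2) by simp
    then obtain y where y: "y \<in> topspace Y" "proj y = x"
      by blast
    have "(h0 y)\<^sup>2 = z\<^sup>2"
      using square[OF y(1)] y(2) p(3) by simp
    then have "h0 y = z \<or> h0 y = - z"
      by (simp only: power2_eq_iff)
    then show "p \<in> (\<lambda>y. (proj y, h0 y)) ` topspace Y"
    proof
      assume "h0 y = z"
      then show ?thesis using p y by blast
    next
      assume "h0 y = - z"
      then have "p = (proj (\<sigma> y), h0 (\<sigma> y))" using p y \<sigma> by simp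
      then show ?thesis using \<sigma>(1)[OF y(1)] by blast
    qed
  qed
  show "inj_on (\<lambda>y. (proj y, h0 y)) (topspace Y)"
    using inj by (auto simp: inj_on_def)
qed

lemma pullback_sqrt_algebra:
  assumes Y: "topspace Y \<noteq> {}" "compact_space Y" and A: "A \<subseteq> C_set X"
    and h0: "h0 \<in> C_set Y"
    and \<psi>: "homeomorphic_map Y (sqrt_space X h) (\<lambda>y. (proj y, h0 y))"
  shows "pullback Y (\<lambda>y. (proj y, h0 y)) (sqrt_fun X h) = h0"
    and "pullback Y (\<lambda>y. (proj y, h0 y)) ` sqrt_algebra X A h
      = generated_uniform_algebra Y (insert h0 (pullback Y proj ` A))"
proof -
  let ?Z = "sqrt_space X h" and ?\<psi> = "\<lambda>y. (proj y, h0 y)"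
  have im: "?\<psi> ` topspace Y = topspace ?Z"
    using \<psi> by (rule homeomorphic_imp_surjective_map)
  have Z: "topspace ?Z \<noteq> {}" "compact_space ?Z"
    using im Y homeomorphic_compact_space[of Y ?Z] \<psi> homeomorphic_map_imp_homeomorphic_space by blast+
  have in_Z: "(proj y, h0 y) \<in> topspace ?Z" if "y \<in> topspace Y" for y
    using im that by blast
  show root: "pullback Y ?\<psi> (sqrt_fun X h) = h0"
    using h0 in_Z by (auto simp: pullback_def sqrt_fun_def C_set_def extensional_def fun_eq_iff)
  have gens: "pullback Y ?\<psi> (pullback ?Z (sqrt_proj X h) f) = pullback Y proj f" for f
    using in_Z by (auto simp: pullback_def sqrt_proj_def fun_eq_iff)
  have fst: "continuous_map ?Z X (sqrt_proj X h)"
    unfolding sqrt_proj_def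
    by (rule continuous_map_eq[of _ _ fst])
      (auto simp: sqrt_space_def intro: continuous_map_from_subtopology continuous_map_fst)
  have "continuous_map ?Z euclidean snd"
    by (auto simp: sqrt_space_def intro: continuous_map_from_subtopology continuous_map_snd)
  then have "sqrt_fun X h \<in> C_set ?Z"
    unfolding sqrt_fun_def by (rule restrict_in_C_set)
  then have "insert (sqrt_fun X h) (pullback ?Z (sqrt_proj X h) ` A) \<subseteq> C_set ?Z"
    using A pullback_in_C_set[OF fst] by auto
  from pullback_generated_uniform_algebra[OF Y Z \<psi> this]
  show "pullback Y ?\<psi> ` sqrt_algebra X A h
      = generated_uniform_algebra Y (insert h0 (pullback Y proj ` A))"
    by (simp add: sqrt_algebra_def root gens image_image)
qed

theorem theorem4p15:
  fixes X :: "'x topology" and Y :: "'y topology"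
    and A :: "('x \<Rightarrow> complex) set" and B :: "('y \<Rightarrow> complex) set"
    and proj :: "'y \<Rightarrow> 'x" and T :: "('y \<Rightarrow> complex) \<Rightarrow> ('x \<Rightarrow> complex)"
  assumes X: "topspace X \<noteq> {}" "compact_space X" "Hausdorff_space X"
    and Y: "topspace Y \<noteq> {}" "compact_space Y" "Hausdorff_space Y"
    and A: "uniform_algebra X A"
    and B: "uniform_algebra Y B"
    and ext: "generalised_Cole_extension X A Y B proj T"
    and norm: "op_norm Y Y (\<lambda>f. \<lambda>y\<in>topspace Y. f y - pullback Y proj (T f) y) = 1"
  shows "(\<exists>G :: nat monoid. finite (carrier G) \<and>
            implemented_by X Y B proj T G (discrete_topology (carrier G))) \<and>
         (\<forall>h0\<in>B. T h0 = (\<lambda>x\<in>topspace X. 0) \<and>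
              B = generated_uniform_algebra Y (insert h0 (pullback Y proj ` A)) \<longrightarrow>
            (\<exists>h\<in>A. \<exists>\<psi>.
               homeomorphic_map Y (sqrt_space X h) \<psi> \<and>
               (\<forall>y\<in>topspace Y. sqrt_proj X h (\<psi> y) = proj y) \<and>
               pullback Y \<psi> ` sqrt_algebra X A h = B \<and>
               pullback Y \<psi> (sqrt_fun X h) = h0))"
proof (intro conjI ballI impI)
  obtain \<sigma> where \<sigma>: "continuous_map Y Y \<sigma>" "\<And>y. y \<in> topspace Y \<Longrightarrow> \<sigma> (\<sigma> y) = y"
    and fibre: "\<And>y. y \<in> topspace Y \<Longrightarrow> {y' \<in> topspace Y. proj y' = proj y} = {y, \<sigma> y}"
    and avg: "\<And>f y. \<lbrakk>f \<in> C_set Y; y \<in> topspace Y\<rbrakk> \<Longrightarrow> T f (proj y) = (f y + f (\<sigma> y)) / 2"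
    using fibre_involution[OF X Y ext norm] by blast
  have B_C: "B \<subseteq> C_set Y" and A_C: "A \<subseteq> C_set X"
    using A B by (auto simp: uniform_algebra_def unital_subalgebra_def)
  have proj: "continuous_map Y X proj" "proj ` topspace Y = topspace X" and TB: "T ` B = A"
    using ext by (auto simp: generalised_Cole_extension_def)
  have "implemented_by X Y B proj T cyclic_group_two (discrete_topology (carrier cyclic_group_two))"
    using B_C by (intro implemented_by_involution[OF \<sigma> fibre avg]) auto
  then show "\<exists>G :: nat monoid. finite (carrier G) \<and>
      implemented_by X Y B proj T G (discrete_topology (carrier G))"
    by (intro exI[of _ cyclic_group_two]) simp

  fix h0 assume h0: "h0 \<in> B"
    and "T h0 = (\<lambda>x\<in>topspace X. 0) \<and>
      B = generated_uniform_algebra Y (insert h0 (pullback Y proj ` A))"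
  then have Th0: "T h0 = (\<lambda>x\<in>topspace X. 0)"
    and gen: "B = generated_uniform_algebra Y (insert h0 (pullback Y proj ` A))"
    by auto
  have in_fibre: "\<sigma> y \<in> topspace Y" "proj (\<sigma> y) = proj y" if "y \<in> topspace Y" for y
    using fibre[OF that] by blast+
  have odd: "h0 (\<sigma> y) = - h0 y" if y: "y \<in> topspace Y" for y
  proof -
    have "proj y \<in> topspace X" using proj(2) y by blast
    then have "(h0 y + h0 (\<sigma> y)) / 2 = 0"
      using avg[of h0 y] h0 B_C y Th0 by auto
    then show ?thesis by (simp add: eq_neg_iff_add_eq_0 add.commute)
  qed
  \<comment> \<open>The square of \<open>h0\<close> is \<open>\<sigma>\<close>-invariant, so averaging it over the fibre merely descends it to \<open>X\<close>.\<close>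
  define h where "h = T (\<lambda>y\<in>topspace Y. h0 y * h0 y)"
  have sq_B: "(\<lambda>y\<in>topspace Y. h0 y * h0 y) \<in> B"
    using B h0 by (auto simp: uniform_algebra_def unital_subalgebra_def)
  have square: "h (proj y) = (h0 y)\<^sup>2" if "y \<in> topspace Y" for y
    using avg[of "\<lambda>y\<in>topspace Y. h0 y * h0 y" y] sq_B B_C that in_fibre[OF that] odd[OF that]
    by (auto simp: h_def power2_eq_square)
  have gens_C: "insert h0 (pullback Y proj ` A) \<subseteq> C_set Y"
    using h0 B_C A_C pullback_in_C_set[OF proj(1)] by auto
  have inj: "y = y'"
    if y: "y \<in> topspace Y" "y' \<in> topspace Y" and eq: "proj y = proj y'" "h0 y = h0 y'" for y y'
  proof (rule ccontr)
    assume "y \<noteq> y'"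
    then obtain f where f: "f \<in> B" "f y \<noteq> f y'"
      using B y by (auto simp: uniform_algebra_def)
    have "g y = g y'" if "g \<in> insert h0 (pullback Y proj ` A)" for g
      using that y eq by (auto simp: pullback_def)
    then have "f y = f y'"
      using generated_uniform_algebra_eq_at[OF Y(1,2) gens_C y] f(1) gen by blast
    then show False using f(2) by simp
  qed
  have \<psi>: "homeomorphic_map Y (sqrt_space X h) (\<lambda>y. (proj y, h0 y))"
    using h0 B_C
    by (intro homeomorphic_map_onto_sqrt_space[OF X(3) Y(2) proj _ square in_fibre odd inj] C_set_continuous) auto
  have "sqrt_proj X h (proj y, h0 y) = proj y" if "y \<in> topspace Y" for y
    using homeomorphic_imp_surjective_map[OF \<psi>] that by (auto simp: sqrt_proj_def)
  moreover have "h \<in> A"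
    using sq_B TB by (auto simp: h_def)
  moreover have "h0 \<in> C_set Y" using h0 B_C by blast
  note pullback_sqrt_algebra[OF Y(1,2) A_C this \<psi>, folded gen]
  ultimately show "\<exists>h\<in>A. \<exists>\<psi>.
      homeomorphic_map Y (sqrt_space X h) \<psi> \<and>
      (\<forall>y\<in>topspace Y. sqrt_proj X h (\<psi> y) = proj y) \<and>
      pullback Y \<psi> ` sqrt_algebra X A h = B \<and>
      pullback Y \<psi> (sqrt_fun X h) = h0"
    using \<psi> by (intro bexI[of _ h] exI[of _ "\<lambda>y. (proj y, h0 y)"] conjI ballI) auto
qed

end
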